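(* If there exists a circulant Hadamard code of length $4t$, then there also exists an $\mathrm{HFP}(4t,4_{\mathbf u})$-code of length $8t$ with kernel $\langle\mathbf u,(\mathbf e_{4t},\mathbf u_{4t})\rangle$.
   Context: Let $\mathbb F$ be the binary field. $C_m$ denotes the cyclic group of order $m$. $\mathbf e_n$ is the all-zero vector and $\mathbf u_n$ the all-one vector of length $n$ (subscripts omitted when clear); $(\mathbf e_{4t},\mathbf u_{4t})\in\mathbb F^{8t}$ is their concatenation. For $\pi\in S_n$ and $x\in\mathbb F^n$, $\pi(x)=(x_{\pi^{-1}(1)},\ldots,x_{\pi^{-1}(n)})$. A Hadamard code of length $n$ is a set of $2n$ binary vectors consisting of the rows of a binary Hadamard matrix of order $n$ (a Hadamard matrix with $1$ replaced by $0$ and $-1$ replaced by $1$) and their complements. All codes are assumed to contain $\mathbf e$. A binary code $C\subseteq\mathbb F^n$ has a propelinear structure if for each $x\in C$ there is $\pi_x\in S_n$ such that for all $y\in C$: $x+\pi_x(y)\in C$, and $\pi_x\pi_y=\pi_z$ where $z=x+\pi_x(y)$. Then $C$ is a group under $x*y=x+\pi_x(y)$ (written multiplicatively), with identity $\mathbf e$. A Hadamard full propelinear code (HFP-code) is a Hadamard code with a propelinear structure such that $\pi_x$ has no fixed coordinate for every $x\in C\setminus\{\mathbf e,\mathbf u\}$, and $\pi_{\mathbf e}=\pi_{\mathbf u}=I$. An $\mathrm{HFP}(4t,4_{\mathbf u})$-code of length $8t$ is an HFP-code $C=\langle a\rangle\times\langle b\rangle\simeq C_{4t}\times C_4$ with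 $a^{4t}=\mathbf e$, $b^2=\mathbf u$. The kernel of $C$ is $K(C)=\{z\in\mathbb F^n : C+z=C\}$, a linear subspace contained in $C$; here $\langle\cdot\rangle$ denotes the linear span over $\mathbb F$. A circulant matrix is a square matrix whose rows are the successive cyclic shifts of a vector. A circulant Hadamard code is the binary code consisting of the rows, and their complements, of a binary normalized Hadamard matrix obtained by normalizing a circulant Hadamard matrix (so a circulant Hadamard code of length $m$ exists iff a circulant Hadamard matrix of order $m$ exists).
   Formalization: The kernel claim is asserted only for t ≠ 1 (existence of the code is asserted for all t ≥ 1): for t = 1 a circulant Hadamard code of length 4 exists, but every Hadamard code of length 8 containing e is linear, so its kernel has 16 elements, not 4. *)

theory Defs
  imports
    "HOL-Library.Z2"
    "HOL-Combinatorics.Permutations"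
    "HOL-Algebra.Elementary_Groups"
    "Jordan_Normal_Form.VS_Connect"
begin

text \<open>
  The binary field is \<^typ>\<open>bit\<close>, and \<open>\<bbbF>\<^sup>n\<close> is \<^term>\<open>carrier_vec n :: bit vec set\<close>.
  Coordinates are numbered \<open>0, \<dots>, n - 1\<close>, so \<open>S\<^sub>n\<close> consists of the \<open>p\<close> with \<open>p permutes {..<n}\<close>.
  The vector \<open>\<^bold>e\<^sub>n\<close> is \<^term>\<open>0\<^sub>v n :: bit vec\<close>.
\<close>

definition ones_vec :: "nat \<Rightarrow> bit vec" where
  "ones_vec n = vec n (\<lambda>_. 1)"

definition hadamard_matrix :: "nat \<Rightarrow> int mat \<Rightarrow> bool" where
  "hadamard_matrix n H \<longleftrightarrow>
     H \<in> carrier_mat n n \<and> elements_mat H \<subseteq> {1, -1} \<and> H * H\<^sup>T = of_nat n \<cdot>\<^sub>m 1\<^sub>m n"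

definition binary_matrix :: "int mat \<Rightarrow> bit mat" where
  "binary_matrix H = map_mat (\<lambda>x. if x = 1 then 0 else 1) H"

definition rows_and_complements :: "nat \<Rightarrow> bit mat \<Rightarrow> bit vec set" where
  "rows_and_complements n B = set (rows B) \<union> (\<lambda>x. x + ones_vec n) ` set (rows B)"

text \<open>The condition \<open>\<^bold>e \<in> C\<close> is the convention that every code contains the zero vector.\<close>

definition hadamard_code :: "nat \<Rightarrow> bit vec set \<Rightarrow> bool" where
  "hadamard_code n C \<longleftrightarrow>
     (\<exists>H. hadamard_matrix n H \<and> C = rows_and_complements n (binary_matrix H)) \<and> 0\<^sub>v n \<in> C"

definition permute_vec :: "(nat \<Rightarrow> nat) \<Rightarrow> bit vec \<Rightarrow> bit vec" where
  "permute_vec p x = vec (dim_vec x) (\<lambda>i. x $ inv_into UNIV p i)"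

definition propelinear_mult ::
    "(bit vec \<Rightarrow> nat \<Rightarrow> nat) \<Rightarrow> bit vec \<Rightarrow> bit vec \<Rightarrow> bit vec" where
  "propelinear_mult \<pi> x y = x + permute_vec (\<pi> x) y"

definition propelinear_structure ::
    "nat \<Rightarrow> bit vec set \<Rightarrow> (bit vec \<Rightarrow> nat \<Rightarrow> nat) \<Rightarrow> bool" where
  "propelinear_structure n C \<pi> \<longleftrightarrow>
     C \<subseteq> carrier_vec n \<and>
     (\<forall>x\<in>C. \<pi> x permutes {..<n} \<and>
        (\<forall>y\<in>C. propelinear_mult \<pi> x y \<in> C \<and> \<pi> x \<circ> \<pi> y = \<pi> (propelinear_mult \<pi> x y)))"

definition propelinear_group ::
    "nat \<Rightarrow> bit vec set \<Rightarrow> (bit vec \<Rightarrow> nat \<Rightarrow> nat) \<Rightarrow> bit vec monoid" where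
  "propelinear_group n C \<pi> = \<lparr>carrier = C, mult = propelinear_mult \<pi>, one = 0\<^sub>v n\<rparr>"

definition hfp_code :: "nat \<Rightarrow> bit vec set \<Rightarrow> (bit vec \<Rightarrow> nat \<Rightarrow> nat) \<Rightarrow> bool" where
  "hfp_code n C \<pi> \<longleftrightarrow>
     hadamard_code n C \<and> propelinear_structure n C \<pi> \<and>
     (\<forall>x\<in>C - {0\<^sub>v n, ones_vec n}. \<forall>i<n. \<pi> x i \<noteq> i) \<and>
     \<pi> (0\<^sub>v n) = id \<and> \<pi> (ones_vec n) = id"

text \<open>
  The equation \<open>C = \<langle>a\<rangle> \<times> \<langle>b\<rangle>\<close> is an internal direct product: multiplication is an isomorphism
  from the external product of the two cyclic subgroups onto the group.
\<close>

definition hfp_4t_4u_code :: "nat \<Rightarrow> bit vec set \<Rightarrow> (bit vec \<Rightarrow> nat \<Rightarrow> nat) \<Rightarrow> bool" where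
  "hfp_4t_4u_code t C \<pi> \<longleftrightarrow>
     hfp_code (8 * t) C \<pi> \<and>
     (let G = propelinear_group (8 * t) C \<pi> in
       \<exists>a\<in>C. \<exists>b\<in>C.
         (\<lambda>(x, y). x \<otimes>\<^bsub>G\<^esub> y) \<in> iso (subgroup_generated G {a} \<times>\<times> subgroup_generated G {b}) G \<and>
         subgroup_generated G {a} \<cong> integer_mod_group (4 * t) \<and>
         subgroup_generated G {b} \<cong> integer_mod_group 4 \<and>
         a [^]\<^bsub>G\<^esub> (4 * t) = 0\<^sub>v (8 * t) \<and>
         b [^]\<^bsub>G\<^esub> (2::nat) = ones_vec (8 * t))"

definition code_kernel :: "nat \<Rightarrow> bit vec set \<Rightarrow> bit vec set" where
  "code_kernel n C = {z \<in> carrier_vec n. (\<lambda>x. x + z) ` C = C}"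

abbreviation binary_span :: "nat \<Rightarrow> bit vec set \<Rightarrow> bit vec set" where
  "binary_span n \<equiv> LinearCombinations.module.span class_ring (module_vec TYPE(bit) n)"

definition circulant_matrix :: "nat \<Rightarrow> 'a mat \<Rightarrow> bool" where
  "circulant_matrix n A \<longleftrightarrow>
     (\<exists>v\<in>carrier_vec n. A = mat n n (\<lambda>(i, j). v $ ((j + n - i) mod n)))"

text \<open>
  Normalizing a Hadamard matrix means negating some rows (those \<open>i\<close> with \<open>r i = -1\<close>) and some
  columns (those \<open>j\<close> with \<open>c j = -1\<close>) so that the first row and the first column become all \<open>1\<close>.
\<close>

definition normalization_of :: "nat \<Rightarrow> int mat \<Rightarrow> int mat \<Rightarrow> bool" where
  "normalization_of n H N \<longleftrightarrow>
     (\<exists>r c. (\<forall>i<n. r i \<in> {1, -1}) \<and> (\<forall>j<n. c j \<in> {1, -1}) \<and>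
        N = mat n n (\<lambda>(i, j). r i * c j * H $$ (i, j))) \<and>
     (\<forall>j<n. N $$ (0, j) = 1) \<and> (\<forall>i<n. N $$ (i, 0) = 1)"

definition circulant_hadamard_code :: "nat \<Rightarrow> bit vec set \<Rightarrow> bool" where
  "circulant_hadamard_code n C \<longleftrightarrow>
     (\<exists>H N. hadamard_matrix n H \<and> circulant_matrix n H \<and> normalization_of n H N \<and>
        C = rows_and_complements n (binary_matrix N))"

end

theory Submission
  imports Defs
begin

text \<open>
  A circulant Hadamard matrix of order \<open>n = 4t\<close> is the same thing as an \<open>n\<close>-periodic sequence \<open>\<beta>\<close>
  of bits whose periodic autocorrelation vanishes off the multiples of \<open>n\<close>.  Writing \<open>P\<close> for the
  matrix, the block matrix with rows \<open>(P, P)\<close> and \<open>(-P, P)\<close> is Hadamard of order \<open>2n\<close>, and it is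
  developed over \<open>C\<^sub>n \<times> C\<^sub>4\<close>: its entries come from a function on that group which changes sign under
  the involution \<open>u\<close> of the factor \<open>C\<^sub>4\<close>.  The group acts on its quotient by \<open>\<langle>u\<rangle>\<close> by translations, and the
  quotient serves as the set of \<open>2n\<close> coordinates.  Normalizing the block matrix by its row at the
  identity turns the translates of the function into codewords \<open>codeword k l\<close>, on which the
  propelinear product adds the indices (\<open>codeword_mult\<close>); distinct elements of \<open>C\<^sub>n \<times> C\<^sub>4\<close> give distinct
  codewords (\<open>codeword_eq_iff\<close>), and a translation has a fixed point only if it is trivial, that is,
  for \<open>1\<close> and \<open>u\<close>.  So the code is an HFP-code, and its group is \<open>C\<^sub>n \<times> C\<^sub>4\<close>.

  The four codewords \<open>codeword 0 l\<close> are constant on both halves of the coordinates, and adding one of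
  them only changes the second index of a codeword; they are the four elements of the required span
  and lie in the kernel.  That the kernel is no larger is a property of \<open>\<beta>\<close> alone: if adding a
  sequence \<open>z\<close> to any shift of \<open>\<beta>\<close> gives a shift of \<open>\<beta>\<close> up to a constant, then \<open>z\<close> is constant
  (\<open>sequence_kernel_constant\<close>).  The sequences \<open>z\<close> with this property form a finite group \<open>K\<close> which
  is invariant under shifts and whose elements are constant or balanced.  If \<open>K\<close> had a nonconstant
  element, then for each \<open>x\<close> the sum over \<open>z \<in> K\<close> of the signs of \<open>z(x) + z(x + 1)\<close> would vanish, as a
  sum over a nontrivial character.  Summing over \<open>x\<close>, the positive contribution of \<open>z = 0\<close> must be
  compensated, so some \<open>w \<in> K\<close> has \<open>w(x) + w(x + 1)\<close> constantly \<open>1\<close>: the alternating sequence lies in \<open>K\<close>.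
  This means that \<open>\<beta>\<close> is its own shift by \<open>2t\<close> up to alternating signs.  Comparing the autocorrelations
  at \<open>2\<close> and \<open>2 + 2t\<close>, both of which vanish when \<open>t > 1\<close>, shows that the sums over the even and over the odd
  positions vanish separately, even when restricted to half a period.  Two sums of \<open>t\<close> signs with
  equal values have equal products of signs, but here both products telescope, to opposite values.
\<close>

section \<open>Bits, signs, and sums\<close>

text \<open>
  The rewrite rule removed here turns sums of bits into exclusive disjunctions, where the group laws
  no longer apply.
\<close>

declare add_bit_eq_xor [simp del]

definition bit_sign :: "bit \<Rightarrow> int" where
  "bit_sign b = (if b = 0 then 1 else -1)"

lemma bit_sign_simps [simp]: "bit_sign 0 = 1" "bit_sign 1 = -1"
  by (simp_all add: bit_sign_def)

lemma bit_add_self [simp]: "(b::bit) + b = 0"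
  by (cases b) simp_all

lemma bit_add_self_left [simp]: "(a::bit) + (a + b) = b"
  by (cases a) simp_all

lemma bit_add_eq_iff: "(a::bit) + b = c \<longleftrightarrow> a = b + c"
  by (cases a; cases b; cases c) simp_all

lemma bit_cancel_middle: "(a::bit) + b + c = a' + b + c' \<longleftrightarrow> a + c = a' + c'"
  by (cases a; cases b; cases c; cases a'; cases c') simp_all

lemma bit_sign_add: "bit_sign (a + b) = bit_sign a * bit_sign b"
  by (cases a; cases b) simp_all

lemma bit_sign_add_one [simp]: "bit_sign (b + 1) = - bit_sign b"
  by (cases b) simp_all

lemma bit_sign_eq_one_or_minus_one: "bit_sign b = 1 \<or> bit_sign b = -1"
  by (cases b) simp_all

text \<open>
  The sum of \<open>t\<close> signs determines how many of them are negative, and the parity of this number is the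
  sum of the bits.
\<close>

lemma sum_bit_sign_determines_sum:
  assumes "(\<Sum>y<t. bit_sign (u y)) = (\<Sum>y<t. bit_sign (v y))"
  shows "(\<Sum>y<(t::nat). u y) = (\<Sum>y<t. v y)"
proof -
  have parity: "(\<Sum>y<t. u y) = of_bool (odd (N u))" 
    "(\<Sum>y<t. bit_sign (u y)) = int t - 2 * int (N u)"
    if "\<And>u. N u = card {y. y < t \<and> u y = 1}" for N u
    unfolding that
  proof (induction t)
    case (Suc t)
    have "{y. y < Suc t \<and> u y = 1} = {y. y < t \<and> u y = 1} \<union> (if u t = 1 then {t} else {})"
      by (auto simp: less_Suc_eq)
    then have card: "card {y. y < Suc t \<and> u y = 1}
        = card {y. y < t \<and> u y = 1} + (if u t = 1 then 1 else 0)"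
      by simp
    {
      case 1
      show ?case using Suc card by (cases "u t") auto
    next
      case 2
      show ?case using Suc card by (cases "u t") auto
    }
  qed simp_all
  show ?thesis
    using assms parity[OF refl, of u] parity[OF refl, of v] by simp
qed

lemma sum_periodic_shift:
  fixes F :: "int \<Rightarrow> int"
  assumes "\<And>x. F (x + int n) = F x"
  shows "(\<Sum>x<n. F (int x + k)) = (\<Sum>x<n. F (int x))"
proof -
  have step: "(\<Sum>x<n. F (int x + (k + 1))) = (\<Sum>x<n. F (int x + k))" for k
  proof -
    have "F k + (\<Sum>x<n. F (int x + (k + 1))) = (\<Sum>x<Suc n. F (int x + k))"
      by (subst sum.lessThan_Suc_shift) (simp add: algebra_simps)
    also have "\<dots> = (\<Sum>x<n. F (int x + k)) + F k"
      using assms[of k] by (simp add: add.commute)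
    finally show ?thesis by simp
  qed
  show ?thesis
  proof (induction k rule: int_induct[where k = 0])
    case (step1 i) then show ?case using step[of i] by simp
  next
    case (step2 i) then show ?case using step[of "i - 1"] by simp
  qed simp
qed

lemma sum_even_odd:
  fixes F :: "nat \<Rightarrow> int"
  shows "(\<Sum>x<2 * m. F x) = (\<Sum>y<m. F (2 * y)) + (\<Sum>y<m. F (2 * y + 1))"
  by (induction m) simp_all

lemma sum_telescope_bit: "(\<Sum>y<t. f y + f (Suc y)) = f 0 + f t" for f :: "nat \<Rightarrow> bit"
proof (induction t)
  case (Suc t)
  then show ?case by (cases "f 0"; cases "f t"; cases "f (Suc t)") simp_all
qed simp

text \<open>
  A homomorphism from the integers is determined by its value at \<open>1\<close>; if its kernel consists of
  the multiples of \<open>m\<close>, it identifies the integers modulo \<open>m\<close> with the cyclic group generated by that value.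
\<close>

lemma (in group) integer_parametrization:
  fixes f :: "int \<Rightarrow> 'a"
  assumes closed: "\<And>i. f i \<in> carrier G" and add: "\<And>i j. f (i + j) = f i \<otimes> f j"
  shows "f 1 [^] i = f i"
    and "carrier (subgroup_generated G {f 1}) = range f"
    and "0 < m \<Longrightarrow> (\<And>i j. f i = f j \<longleftrightarrow> int m dvd i - j) \<Longrightarrow> subgroup_generated G {f 1} \<cong> integer_mod_group m"
proof -
  show pow: "f 1 [^] i = f i" for i
  proof (induction i rule: int_induct[where k = 0])
    case base
    have "f 0 \<otimes> f 0 = f 0 \<otimes> \<one>" using add[of 0 0] closed by simp
    then show ?case using closed by simp
  next
    case (step1 i)
    then show ?case using add[of i 1] int_pow_mult[OF closed, of 1 i 1] closed by simp
  next
    case (step2 i)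
    have "f 1 [^] (i - 1) \<otimes> f 1 = f (i - 1) \<otimes> f 1"
      using step2 add[of "i - 1" 1] int_pow_mult[OF closed, of 1 "i - 1" 1] closed by simp
    then show ?case using closed by simp
  qed
  show carrier: "carrier (subgroup_generated G {f 1}) = range f"
    unfolding carrier_subgroup_generated_by_singleton[OF closed] pow ..
  show "subgroup_generated G {f 1} \<cong> integer_mod_group m"
    if m: "0 < m" and eq: "\<And>i j. f i = f j \<longleftrightarrow> int m dvd i - j"
  proof -
    have mod: "f (i mod int m) = f i" for i unfolding eq by (simp add: mod_eq_dvd_iff[symmetric])
    have "f \<in> iso (integer_mod_group m) (subgroup_generated G {f 1})"
    proof (rule isoI)
      show "f \<in> hom (integer_mod_group m) (subgroup_generated G {f 1})"
        by (rule homI) (auto simp: carrier mod add)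
      have "inj_on f {0..<int m}"
        by (rule inj_onI) (simp add: eq mod_eq_dvd_iff[symmetric])
      moreover have "f ` {0..<int m} = range f"
      proof (intro equalityI subsetI)
        fix x assume "x \<in> range f"
        then obtain i where "x = f (i mod int m)" using mod by auto
        then show "x \<in> f ` {0..<int m}" using m by simp
      qed auto
      ultimately show "bij_betw f (carrier (integer_mod_group m)) (carrier (subgroup_generated G {f 1}))"
        using m by (simp add: bij_betw_def carrier carrier_integer_mod_group)
    qed
    then have "integer_mod_group m \<cong> subgroup_generated G {f 1}" by (rule is_isoI)
    then show ?thesis by (rule group.iso_sym[OF group_integer_mod_group])
  qed
qed

section \<open>Perfect binary sequences\<close>

locale perfect_binary_sequence =
  fixes n :: nat and \<beta> :: "int \<Rightarrow> bit"
  assumes length_pos: "0 < n"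
    and periodic: "\<beta> (x + int n) = \<beta> x"
    and autocorrelation:
      "(\<Sum>x<n. bit_sign (\<beta> (int x) + \<beta> (int x + k))) = (if int n dvd k then int n else 0)"
begin

lemma periodic_multiple: "\<beta> (x + int n * q) = \<beta> x"
proof (induction q rule: int_induct[where k = 0])
  case (step1 i)
  then show ?case using periodic[of "x + int n * i"] by (simp add: algebra_simps)
next
  case (step2 i)
  then show ?case using periodic[of "x + int n * (i - 1)"] by (simp add: algebra_simps)
qed simp

lemma periodic_dvd: "int n dvd x - y \<Longrightarrow> \<beta> x = \<beta> y"
  using periodic_multiple[of y "(x - y) div int n"] by simp

lemma crosscorrelation:
  "(\<Sum>x<n. bit_sign (\<beta> (int x + k) + \<beta> (int x + l))) = (if int n dvd l - k then int n else 0)"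
proof -
  have "(\<Sum>x<n. bit_sign (\<beta> (int x + k) + \<beta> (int x + l)))
      = (\<Sum>x<n. (\<lambda>x. bit_sign (\<beta> x + \<beta> (x + (l - k)))) (int x + k))"
    by (simp add: algebra_simps)
  also have "\<dots> = (\<Sum>x<n. bit_sign (\<beta> (int x) + \<beta> (int x + (l - k))))"
    by (rule sum_periodic_shift) (metis periodic add.commute add.left_commute)
  finally show ?thesis using autocorrelation by simp
qed

text \<open>
  If two shifts of \<open>\<beta>\<close> differ by a constant, their correlation has absolute value \<open>n\<close>, which leaves only
  the trivial possibility.
\<close>

lemma shift_eq_up_to_constant:
  assumes "\<And>x. \<beta> (x + l) = \<beta> (x + k) + c"
  shows "int n dvd l - k" and "c = 0"
proof -
  have sum: "int n * bit_sign c = (if int n dvd l - k then int n else 0)"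
    using crosscorrelation[of k l] assms by (simp add: bit_sign_add)
  then show dvd: "int n dvd l - k"
    using bit_sign_eq_one_or_minus_one[of c] length_pos by (auto split: if_splits)
  show "c = 0" using assms[of 0] periodic_dvd[of l k] dvd by (simp)
qed

text \<open>
  This is the kernel, in the sense of codes, of the set of all shifts of \<open>\<beta>\<close> and their complements.
\<close>

definition sequence_kernel :: "(int \<Rightarrow> bit) set" where
  "sequence_kernel = {z. \<forall>m. \<exists>k c. \<forall>i. z i + \<beta> (i + m) = \<beta> (i + k) + c}"

lemma sequence_kernel_add:
  assumes z: "z \<in> sequence_kernel" and w: "w \<in> sequence_kernel"
  shows "(\<lambda>i. z i + w i) \<in> sequence_kernel"
  unfolding sequence_kernel_def
proof (intro CollectI allI)
  fix m
  obtain k c where w: "\<And>i. w i + \<beta> (i + m) = \<beta> (i + k) + c"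
    using w unfolding sequence_kernel_def by blast
  obtain l d where "\<And>i. z i + \<beta> (i + k) = \<beta> (i + l) + d"
    using z unfolding sequence_kernel_def by blast
  then have "z i + w i + \<beta> (i + m) = \<beta> (i + l) + (d + c)" for i
    using w[of i] by (metis add.assoc)
  then show "\<exists>k c. \<forall>i. z i + w i + \<beta> (i + m) = \<beta> (i + k) + c" by blast
qed

lemma sequence_kernel_shift:
  assumes "z \<in> sequence_kernel"
  shows "(\<lambda>i. z (i + j)) \<in> sequence_kernel"
  unfolding sequence_kernel_def
proof (intro CollectI allI)
  fix m
  obtain k c where "\<And>i. z i + \<beta> (i + (m - j)) = \<beta> (i + k) + c"
    using assms unfolding sequence_kernel_def by blast
  from this[of "i + j" for i] have "z (i + j) + \<beta> (i + m) = \<beta> (i + (j + k)) + c" for i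
    by (simp add: algebra_simps)
  then show "\<exists>k c. \<forall>i. z (i + j) + \<beta> (i + m) = \<beta> (i + k) + c" by blast
qed

lemma sequence_kernel_form:
  assumes "z \<in> sequence_kernel"
  shows "\<exists>k c. \<forall>i. z i = \<beta> i + \<beta> (i + k) + c"
proof -
  obtain k c where "\<And>i. z i + \<beta> (i + 0) = \<beta> (i + k) + c"
    using assms unfolding sequence_kernel_def by blast
  then have "z i = \<beta> i + \<beta> (i + k) + c" for i
    by (metis add.right_neutral add.assoc bit_add_eq_iff)
  then show ?thesis by blast
qed

lemma finite_sequence_kernel: "finite sequence_kernel"
proof (rule finite_subset)
  let ?f = "\<lambda>(k, c). \<lambda>i. \<beta> i + \<beta> (i + k) + c"
  have "finite (UNIV :: bit set)"
    using finite_subset[of UNIV "{0, 1 :: bit}"] by (metis (full_types) bit.exhaust finite.emptyI finite.insertI insert_iff subsetI)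
  then show "finite (?f ` ({0..<int n} \<times> UNIV))" by simp
  show "sequence_kernel \<subseteq> ?f ` ({0..<int n} \<times> UNIV)"
  proof
    fix z assume "z \<in> sequence_kernel"
    then obtain k c where z: "\<And>i. z i = \<beta> i + \<beta> (i + k) + c"
      using sequence_kernel_form by blast
    have "\<beta> (i + k) = \<beta> (i + k mod int n)" for i
      by (rule periodic_dvd) (simp add: algebra_simps minus_mod_eq_mult_div)
    then have "z = ?f (k mod int n, c)" using z by auto
    moreover have "(k mod int n, c) \<in> {0..<int n} \<times> UNIV" using length_pos by simp
    ultimately show "z \<in> ?f ` ({0..<int n} \<times> UNIV)" by blast
  qed
qed

text \<open>
  Up to a constant, an element of the kernel is the sum of two shifts of \<open>\<beta>\<close>, so its sum of signs is an
  autocorrelation up to sign, hence \<open>0\<close> or \<open>n\<close> or \<open>-n\<close>.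
\<close>

lemma sequence_kernel_negative_sum:
  assumes "z \<in> sequence_kernel" and "(\<Sum>x<n. bit_sign (z (int x))) < 0"
  shows "z i = 1"
proof -
  obtain k c where z: "\<And>i. z i = \<beta> i + \<beta> (i + k) + c"
    using sequence_kernel_form[OF assms(1)] by blast
  have "(\<Sum>x<n. bit_sign (z (int x))) = (\<Sum>x<n. bit_sign (\<beta> (int x) + \<beta> (int x + k))) * bit_sign c"
    unfolding z bit_sign_add[of _ c] by (simp add: sum_distrib_right)
  then have "(if int n dvd k then int n else 0) * bit_sign c < 0"
    using assms(2) autocorrelation by simp
  then have "int n dvd k" "bit_sign c < 0"
    by (auto split: if_splits simp: mult_less_0_iff)
  then have "c = 1" "\<beta> (i + k) = \<beta> i"
    using periodic_dvd[of "i + k" i] by (auto simp: bit_sign_def split: if_splits)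
  then show ?thesis using z[of i] by simp
qed

text \<open>
  For fixed \<open>x\<close>, the sign of \<open>w(x) + w(x + 1)\<close> is a character of the kernel.  By shift invariance a
  nonconstant element makes it nontrivial for every \<open>x\<close>, so its sum over the kernel is \<open>0\<close>.  The
  term of \<open>w = 0\<close> in the sum over all \<open>x\<close> is \<open>n > 0\<close>, hence some other term is negative.
\<close>

lemma alternating_in_sequence_kernel:
  assumes z: "z \<in> sequence_kernel" and nonconst: "z i \<noteq> z j"
  obtains w where "w \<in> sequence_kernel" and "\<And>i. w (i + 1) = w i + 1"
proof -
  obtain y where y: "z (y + 1) \<noteq> z y"
  proof (rule ccontr)
    assume "\<not> thesis"
    then have step: "z (y + 1) = z y" for y using that by blast
    have "z y = z 0" for y
    proof (induction y rule: int_induct[where k = 0])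
      case (step2 i) then show ?case using step[of "i - 1"] by simp
    qed (simp_all add: step)
    then show False using nonconst by metis
  qed
  have "(\<Sum>w\<in>sequence_kernel. bit_sign (w x + w (x + 1))) = 0" for x :: int
  proof -
    \<comment> \<open>Shifting \<open>z\<close> moves its change of value from \<open>y\<close> to \<open>x\<close>; adding the result to \<open>w\<close> reverses every sign.\<close>
    define v where "v = (\<lambda>i. z (i + (y - x)))"
    have v: "v \<in> sequence_kernel" unfolding v_def by (rule sequence_kernel_shift[OF z])
    have "v x + v (x + 1) \<noteq> 0"
      using y unfolding v_def by (metis add.commute add.left_commute add.right_neutral add_diff_cancel_left' bit_add_eq_iff diff_add_cancel)
    then have vx: "v x + v (x + 1) = 1" by simp
    have "(\<Sum>w\<in>sequence_kernel. bit_sign (w x + w (x + 1)))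
        = (\<Sum>w\<in>sequence_kernel. bit_sign ((v x + w x) + (v (x + 1) + w (x + 1))))"
      by (rule sum.reindex_bij_witness[where i = "\<lambda>w i. v i + w i" and j = "\<lambda>w i. v i + w i"])
        (auto simp: sequence_kernel_add v)
    also have "\<dots> = (\<Sum>w\<in>sequence_kernel. bit_sign ((w x + w (x + 1)) + (v x + v (x + 1))))"
      by (simp add: ac_simps)
    also have "\<dots> = - (\<Sum>w\<in>sequence_kernel. bit_sign (w x + w (x + 1)))"
      unfolding vx by (simp add: sum_negf)
    finally show ?thesis by simp
  qed
  then have "(\<Sum>x<n. \<Sum>w\<in>sequence_kernel. bit_sign (w (int x) + w (int x + 1))) = 0" by simp
  then have total: "(\<Sum>w\<in>sequence_kernel. \<Sum>x<n. bit_sign (w (int x) + w (int x + 1))) = 0"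
    by (subst sum.swap)
  have zero: "(\<lambda>i. 0) \<in> sequence_kernel"
    unfolding sequence_kernel_def by simp (metis add.right_neutral)
  have "\<exists>w\<in>sequence_kernel. (\<Sum>x<n. bit_sign (w (int x) + w (int x + 1))) < 0"
  proof (rule ccontr)
    assume "\<not> ?thesis"
    then have "(\<Sum>x<n. bit_sign ((\<lambda>i. 0) (int x) + (\<lambda>i. 0) (int x + 1)))
        \<le> (\<Sum>w\<in>sequence_kernel. \<Sum>x<n. bit_sign (w (int x) + w (int x + 1)))"
      by (intro member_le_sum[OF zero]) (auto simp: finite_sequence_kernel not_less)
    then show False using total length_pos by simp
  qed
  then obtain w where w: "w \<in> sequence_kernel"
    and neg: "(\<Sum>x<n. bit_sign (w (int x) + w (int x + 1))) < 0" by blast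
  have "w i + w (i + 1) = 1" for i
    using sequence_kernel_negative_sum[OF sequence_kernel_add[OF w sequence_kernel_shift[OF w, of 1]], of i] neg
    by simp
  then have "w (i + 1) = w i + 1" for i by (metis add.commute bit_add_eq_iff)
  then show ?thesis using that w by blast
qed

text \<open>
  An alternating element makes \<open>\<beta>\<close> equal to its own shift by some \<open>k\<close> up to alternating signs.
  Shifting twice shows that \<open>n\<close> divides \<open>2 k\<close>, so \<open>k\<close> is half a period.  The sequence then splits into
  its even positions, which have period \<open>2 t\<close> up to one global sign, and its odd positions, which
  have period \<open>2 t\<close> up to the opposite sign.
\<close>

lemma no_alternating_in_sequence_kernel:
  assumes n: "n = 4 * t" and t: "1 < t" and z: "z \<in> sequence_kernel"
    and alt: "\<And>i. z (i + 1) = z i + 1"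
  shows False
proof -
  obtain k c where zk: "\<And>i. z i = \<beta> i + \<beta> (i + k) + c"
    using sequence_kernel_form[OF z] by blast
  have shift_k: "\<beta> (i + k) = z i + \<beta> i + c" for i
    unfolding zk by (simp add: add.assoc)
  have not_dvd_k: "\<not> int n dvd k"
    using alt[of 0] zk[of 0] zk[of 1] periodic_dvd[of "0 + k" 0] periodic_dvd[of "1 + k" 1] by auto
  have z_shift: "z (i + l) = z i + (z 0 + z l)" for i l
  proof (induction i rule: int_induct[where k = 0])
    case (step1 i)
    then show ?case using alt[of i] alt[of "i + l"] by (simp add: ac_simps)
  next
    case (step2 i)
    then show ?case using alt[of "i - 1"] alt[of "i + l - 1"]
      by (simp add: algebra_simps) 
  qed (simp add: add.commute)
  have "\<beta> (i + 2 * k) = \<beta> (i + 0) + (z 0 + z k)" for i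
    using shift_k[of "i + k"] shift_k[of i] z_shift[of i k]
    by (cases "z i"; cases c) (simp_all add: algebra_simps)
  then have "int n dvd 2 * k - 0" by (rule shift_eq_up_to_constant)
  then obtain q where "2 * k = int n * q" by (auto elim: dvdE)
  then have q: "k = 2 * int t * q" unfolding n by simp
  have "odd q" using not_dvd_k unfolding n q by (auto elim!: evenE)
  then obtain r where "q = 2 * r + 1" by (rule oddE)
  then have k: "k = 2 * int t + int n * r" unfolding q n by (simp add: algebra_simps)
  have shift: "\<beta> (i + 2 * int t) = z i + \<beta> i + c" for i
    using shift_k[of i] periodic_multiple[of "i + 2 * int t" r] unfolding k by (simp add: add.assoc)
  have z_even: "z (2 * int y) = z 0" for y
  proof (induction y)
    case (Suc y)
    have "z (2 * int (Suc y)) = z (2 * int y + 1 + 1)" by (simp add: algebra_simps)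
    then show ?case using Suc unfolding alt by (simp add: add.assoc)
  qed simp
  have z_two: "z (x + 2) = z x" for x using alt[of x] alt[of "x + 1"] by (simp add: add.assoc)
  \<comment> \<open>The autocorrelation at \<open>2\<close> is \<open>E + O'\<close>; the one at \<open>2 + 2 t\<close> is \<open>E - O'\<close> up to sign.\<close>
  define F where "F = (\<lambda>x. bit_sign (\<beta> x + \<beta> (x + 2)))"
  define E where "E = (\<Sum>y<2 * t. F (2 * int y))"
  define O' where "O' = (\<Sum>y<2 * t. F (2 * int y + 1))"
  have F_shift: "F (x + 2 * int t) = F x" for x
  proof -
    have "\<beta> (x + 2 * int t + 2) = z (x + 2) + \<beta> (x + 2) + c"
      using shift[of "x + 2"] by (simp add: algebra_simps)
    then have "\<beta> (x + 2 * int t) + \<beta> (x + 2 * int t + 2) = \<beta> x + \<beta> (x + 2)"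
      unfolding shift[of x] z_two by (cases "z x"; cases c) simp_all
    then show ?thesis unfolding F_def by simp
  qed
  have n2: "n = 2 * (2 * t)" using n by simp
  have "\<not> int n dvd 2" using t unfolding n by (auto dest!: zdvd_imp_le)
  then have "E + O' = 0"
    using autocorrelation[of 2] sum_even_odd[of "\<lambda>x. F (int x)" "2 * t"]
    unfolding E_def O'_def F_def n2 by (simp add: ac_simps)
  moreover have "E - O' = 0"
  proof -
    have "\<beta> x + \<beta> (x + (2 + 2 * int t)) = \<beta> x + \<beta> (x + 2) + (z x + c)" for x
      using shift[of "x + 2"] unfolding z_two by (simp add: algebra_simps)
    then have sign: "bit_sign (\<beta> x + \<beta> (x + (2 + 2 * int t))) = F x * bit_sign (z x + c)" for x
      unfolding F_def by (simp only: bit_sign_add)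
    have "\<not> int n dvd 2 + 2 * int t" using t unfolding n by (auto dest!: zdvd_imp_le)
    then have "(\<Sum>x<2 * (2 * t). F (int x) * bit_sign (z (int x) + c)) = 0"
      using autocorrelation[of "2 + 2 * int t"] unfolding sign n2 by simp
    also have "(\<Sum>x<2 * (2 * t). F (int x) * bit_sign (z (int x) + c)) = (E - O') * bit_sign (z 0 + c)"
      unfolding sum_even_odd[of _ "2 * t"] E_def O'_def
      by (simp add: z_even alt bit_sign_add sum_distrib_right sum_negf left_diff_distrib
          mult.assoc add.commute[of 1])
    finally show ?thesis using bit_sign_eq_one_or_minus_one[of "z 0 + c"] by auto
  qed
  ultimately have "E = 0" "O' = 0" by simp_all
  \<comment> \<open>The summands repeat after \<open>t\<close> terms, so the sums over \<open>t\<close> terms vanish too; only over that range do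
     the bits telescope to the two ends of half a period.\<close>
  have half: "(\<Sum>y<2 * t. F (2 * int y + j)) = 2 * (\<Sum>y<t. F (2 * int y + j))" for j
  proof -
    have "(\<Sum>y<t + s. F (2 * int y + j)) = (\<Sum>y<t. F (2 * int y + j)) + (\<Sum>y<s. F (2 * int y + j))" for s
    proof (induction s)
      case (Suc s)
      then show ?case using F_shift[of "2 * int s + j"] by (simp add: algebra_simps)
    qed simp
    from this[of t] show ?thesis by (simp only: mult_2)
  qed
  have "(\<Sum>y<t. bit_sign (\<beta> (2 * int y) + \<beta> (2 * int (Suc y))))
      = (\<Sum>y<t. bit_sign (\<beta> (2 * int y + 1) + \<beta> (2 * int (Suc y) + 1)))"
    using half[of 0] half[of 1] \<open>E = 0\<close> \<open>O' = 0\<close> unfolding E_def O'_def F_def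
    by (simp add: algebra_simps)
  then have "(\<Sum>y<t. \<beta> (2 * int y) + \<beta> (2 * int (Suc y)))
      = (\<Sum>y<t. \<beta> (2 * int y + 1) + \<beta> (2 * int (Suc y) + 1))"
    by (rule sum_bit_sign_determines_sum)
  then have "\<beta> 0 + \<beta> (2 * int t) = \<beta> 1 + \<beta> (2 * int t + 1)"
    using sum_telescope_bit[of "\<lambda>y. \<beta> (2 * int y)" t] sum_telescope_bit[of "\<lambda>y. \<beta> (2 * int y + 1)" t]
    by (simp only: of_nat_0 mult_zero_right add_0_left)
  then show False
    using shift[of 0] shift[of 1] alt[of 0]
    by (cases "z 0"; cases c) (simp_all add: add.commute)
qed

theorem sequence_kernel_constant:
  assumes "n = 4 * t" and "1 < t" and "z \<in> sequence_kernel"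
  shows "z i = z j"
  using alternating_in_sequence_kernel[OF assms(3)] no_alternating_in_sequence_kernel[OF assms(1,2)]
  by metis



section \<open>The code and its translations\<close>

text \<open>
  Coordinates are the elements of \<open>C\<^sub>n \<times> C\<^sub>2\<close>, given by integer representatives; the pair \<open>(i, j)\<close> lies in the
  half with number \<open>j mod 2\<close>.
\<close>

definition position :: "int \<Rightarrow> int \<Rightarrow> nat" where
  "position i j = nat (i mod int n) + n * nat (j mod 2)"

lemma position_less: "position i j < 2 * n"
proof -
  have "nat (i mod int n) < n" using length_pos by (simp add: nat_less_iff)
  moreover have "nat (j mod 2) = 0 \<or> nat (j mod 2) = 1" by linarith
  ultimately show ?thesis unfolding position_def by auto
qed

lemma position_mod: "int (position i j mod n) = i mod int n"
  and position_div: "int (position i j div n) = j mod 2"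
  using length_pos by (simp_all add: position_def nat_less_iff)

lemma position_eq_iff: "position i j = position i' j' \<longleftrightarrow> int n dvd i - i' \<and> 2 dvd j - j'"
proof -
  have "position i j = position i' j' \<longleftrightarrow> i mod int n = i' mod int n \<and> j mod 2 = j' mod 2"
    by (metis position_mod position_div position_def)
  then show ?thesis by (simp add: mod_eq_dvd_iff)
qed

lemma position_cases:
  assumes "p < 2 * n"
  shows "\<exists>i j. p = position i j \<and> (j = 0 \<or> j = 1)"
proof -
  have "p div n < 2" using assms length_pos by (simp add: div_less_iff_less_mult)
  moreover have "p = position (int (p mod n)) (int (p div n))"
    unfolding position_def using \<open>p div n < 2\<close> by (simp flip: of_nat_mod)
  ultimately show ?thesis by (metis less_2_cases of_nat_0 of_nat_1 One_nat_def)
qed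

definition translation :: "int \<Rightarrow> int \<Rightarrow> nat \<Rightarrow> nat" where
  "translation k l p =
     (if p < 2 * n then position (int (p mod n) + k) (int (p div n) + l) else p)"

lemma translation_position: "translation k l (position i j) = position (i + k) (j + l)"
  unfolding translation_def
  by (simp add: position_less position_mod position_div position_eq_iff mod_eq_dvd_iff[symmetric]
      mod_add_left_eq)

lemma translation_comp: "translation k l \<circ> translation k' l' = translation (k + k') (l + l')"
proof
  fix p
  show "(translation k l \<circ> translation k' l') p = translation (k + k') (l + l') p"
  proof (cases "p < 2 * n")
    case True
    then obtain i j where "p = position i j" using position_cases by blast
    then show ?thesis by (simp add: translation_position ac_simps)
  qed (simp add: translation_def)
qed

lemma translation_eq:
  assumes "int n dvd k - k'" and "2 dvd l - l'"
  shows "translation k l = translation k' l'"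
  using assms by (auto simp: translation_def position_eq_iff fun_eq_iff)

lemma translation_zero: "translation 0 0 = id"
proof
  fix p
  show "translation 0 0 p = id p"
  proof (cases "p < 2 * n")
    case True
    then obtain i j where "p = position i j" using position_cases by blast
    then show ?thesis by (simp add: translation_position)
  qed (simp add: translation_def)
qed

lemma translation_inverse: "inv_into UNIV (translation k l) = translation (- k) (- l)"
  by (rule inv_unique_comp) (simp_all add: translation_comp translation_zero)

lemma translation_permutes: "translation k l permutes {..<2 * n}"
  unfolding permutes_def
proof (intro conjI allI impI)
  show "translation k l p = p" if "p \<notin> {..<2 * n}" for p using that by (simp add: translation_def)
  show "\<exists>!p. translation k l p = q" for q
  proof (rule ex1I)
    show "translation k l (translation (- k) (- l) q) = q"
      using translation_comp[of k l "- k" "- l"] by (simp add: translation_zero fun_eq_iff)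
    show "p = translation (- k) (- l) q" if "translation k l p = q" for p
      using that translation_comp[of "- k" "- l" k l] by (auto simp: translation_zero fun_eq_iff)
  qed
qed

lemma translation_fixed_point:
  assumes "p < 2 * n" and "translation k l p = p"
  shows "int n dvd k" and "2 dvd l"
proof -
  obtain i j where "p = position i j" using position_cases[OF assms(1)] by blast
  with assms(2) show "int n dvd k" and "2 dvd l"
    by (simp_all add: translation_position position_eq_iff)
qed

text \<open>
  On \<open>C\<^sub>4\<close> this function is \<open>0, 0, 1, 1\<close>.  Adding the involution \<open>2\<close> complements it, and the correction
  that arises when \<open>j\<close> is replaced by its residue modulo \<open>2\<close> is its own value at \<open>j\<close>: this is the cocycle of the
  extension of \<open>C\<^sub>2\<close> by \<open>C\<^sub>2\<close> that yields \<open>C\<^sub>4\<close>.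
\<close>

definition quarter_bit :: "int \<Rightarrow> bit" where
  "quarter_bit j = (if j mod 4 < 2 then 0 else 1)"

lemma quarter_bit_add_two: "quarter_bit (j + 2) = quarter_bit j + 1"
proof -
  have "(j + 2) mod 4 < 2 \<longleftrightarrow> \<not> j mod 4 < 2" by presburger
  then show ?thesis by (simp add: quarter_bit_def)
qed

lemma quarter_bit_cong: "4 dvd j - j' \<Longrightarrow> quarter_bit j = quarter_bit j'"
  by (simp add: quarter_bit_def mod_eq_dvd_iff[symmetric])

lemma quarter_bit_cocycle: "quarter_bit j + quarter_bit (j mod 2 - l) = quarter_bit (j - l)"
proof -
  consider "j mod 4 = 0" | "j mod 4 = 1" | "j mod 4 = 2" | "j mod 4 = 3" by linarith
  then show ?thesis
  proof cases
    case 1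
    then have "quarter_bit j = 0" "j mod 2 = 0" "4 dvd (j - l) - (0 - l)"
      by (simp add: quarter_bit_def, presburger, presburger)
    then show ?thesis using quarter_bit_cong[of "j - l" "0 - l"] by simp
  next
    case 2
    then have "quarter_bit j = 0" "j mod 2 = 1" "4 dvd (j - l) - (1 - l)"
      by (simp add: quarter_bit_def, presburger, presburger)
    then show ?thesis using quarter_bit_cong[of "j - l" "1 - l"] by simp
  next
    case 3
    then have "quarter_bit j = 1" "j mod 2 = 0" "4 dvd (j - l) - (0 - l + 2)"
      by (simp add: quarter_bit_def, presburger, presburger)
    then show ?thesis using quarter_bit_cong[of "j - l" "0 - l + 2"] quarter_bit_add_two[of "0 - l"]
      by (simp add: add.commute)
  next
    case 4
    then have "quarter_bit j = 1" "j mod 2 = 1" "4 dvd (j - l) - (1 - l + 2)"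
      by (simp add: quarter_bit_def, presburger, presburger)
    then show ?thesis using quarter_bit_cong[of "j - l" "1 - l + 2"] quarter_bit_add_two[of "1 - l"]
      by (simp add: add.commute)
  qed
qed

lemma quarter_bit_separates:
  assumes "quarter_bit (0 - l) = quarter_bit (0 - l')" and "quarter_bit (1 - l) = quarter_bit (1 - l')"
  shows "4 dvd l - l'"
proof -
  have residue: "l mod 4 = (if quarter_bit (0 - l) = 0
      then (if quarter_bit (1 - l) = 0 then 0 else 3)
      else (if quarter_bit (1 - l) = 0 then 1 else 2))" for l
  proof -
    consider "l mod 4 = 0" | "l mod 4 = 1" | "l mod 4 = 2" | "l mod 4 = 3" by linarith
    then show ?thesis
    proof cases
      case 1 then have "(0 - l) mod 4 = 0" "(1 - l) mod 4 = 1" by presburger+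
      then show ?thesis using 1 by (simp add: quarter_bit_def)
    next
      case 2 then have "(0 - l) mod 4 = 3" "(1 - l) mod 4 = 0" by presburger+
      then show ?thesis using 2 by (simp add: quarter_bit_def)
    next
      case 3 then have "(0 - l) mod 4 = 2" "(1 - l) mod 4 = 3" by presburger+
      then show ?thesis using 3 by (simp add: quarter_bit_def)
    next
      case 4 then have "(0 - l) mod 4 = 1" "(1 - l) mod 4 = 2" by presburger+
      then show ?thesis using 4 by (simp add: quarter_bit_def)
    qed
  qed
  then have "l mod 4 = l' mod 4" using assms residue[of l] residue[of l'] by simp
  then show ?thesis by (simp add: mod_eq_dvd_iff)
qed

text \<open>
  For \<open>f (i, j) = \<beta> i + quarter_bit j\<close> on \<open>C\<^sub>n \<times> C\<^sub>4\<close>, this is the translate of \<open>f\<close> by \<open>(k, l)\<close> plus \<open>f\<close>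
  itself, at the representatives of the coordinates.  The term \<open>quarter_bit j\<close> of \<open>f\<close> is \<open>0\<close> there.
\<close>

definition codeword :: "int \<Rightarrow> int \<Rightarrow> bit vec" where
  "codeword k l = vec (2 * n) (\<lambda>p.
     \<beta> (int (p mod n) - k) + \<beta> (int (p mod n)) + quarter_bit (int (p div n) - l))"

lemma dim_codeword [simp]: "dim_vec (codeword k l) = 2 * n"
  by (simp add: codeword_def)

lemma codeword_carrier [simp]: "codeword k l \<in> carrier_vec (2 * n)"
  by (rule carrier_vecI) simp

lemma beta_mod: "\<beta> (i mod int n + d) = \<beta> (i + d)"
  by (rule periodic_dvd) (metis mod_add_left_eq mod_eq_dvd_iff)

lemma codeword_position_mod:
  "codeword k l $ position i j = \<beta> (i - k) + \<beta> i + quarter_bit (j mod 2 - l)"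
  using beta_mod[of i "- k"] beta_mod[of i 0]
  by (simp add: codeword_def position_less position_mod position_div)

lemma codeword_position:
  "j = 0 \<or> j = 1 \<Longrightarrow> codeword k l $ position i j = \<beta> (i - k) + \<beta> i + quarter_bit (j - l)"
  using codeword_position_mod[of k l i j] by auto

lemma eq_vec_positionI:
  assumes "v \<in> carrier_vec (2 * n)" and "w \<in> carrier_vec (2 * n)"
    and "\<And>i j. j = 0 \<or> j = 1 \<Longrightarrow> v $ position i j = w $ position i j"
  shows "v = w"
proof (rule eq_vecI)
  fix p assume "p < dim_vec w"
  then have "p < 2 * n" using assms(2) by simp
  then obtain i j where "p = position i j" "j = 0 \<or> j = 1" using position_cases by blast
  then show "v $ p = w $ p" using assms(3) by simp
qed (use assms in simp)

text \<open>
  Equality of two codewords says that two shifts of \<open>\<beta>\<close> differ by a constant on each half.  Then the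
  shifts agree modulo \<open>n\<close> and the constants vanish, and the values of \<open>quarter_bit\<close> at two neighbouring
  arguments determine the residue modulo \<open>4\<close>.
\<close>

lemma codeword_eq_iff: "codeword k l = codeword k' l' \<longleftrightarrow> int n dvd k - k' \<and> 4 dvd l - l'"
proof
  assume eq: "codeword k l = codeword k' l'"
  have cancel: "\<beta> (i - k) + quarter_bit (j - l) = \<beta> (i - k') + quarter_bit (j - l')"
    if "j = 0 \<or> j = 1" for i j
    using codeword_position[OF that, of k l i] codeword_position[OF that, of k' l' i] unfolding eq
    by (simp add: bit_cancel_middle)
  have shift: "\<beta> (i + (- k)) = \<beta> (i + (- k')) + (quarter_bit (j - l') + quarter_bit (j - l))"
    if "j = 0 \<or> j = 1" for i j
    using cancel[OF that, of i] by (simp add: bit_add_eq_iff add.assoc)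
  have "int n dvd - k - - k'" by (rule shift_eq_up_to_constant(1)[OF shift[where j = 0]]) simp
  then have "int n dvd - (k - k')" by simp
  then have "int n dvd k - k'" by (simp only: dvd_minus_iff)
  moreover have "quarter_bit (j - l') + quarter_bit (j - l) = 0" if "j = 0 \<or> j = 1" for j
    using shift_eq_up_to_constant(2)[OF shift[OF that]] .
  then have "quarter_bit (j - l) = quarter_bit (j - l')" if "j = 0 \<or> j = 1" for j
    using that by (metis add.right_neutral bit_add_eq_iff)
  from this[of 0] this[of 1] have "4 dvd l - l'" by (intro quarter_bit_separates) simp_all
  ultimately show "int n dvd k - k' \<and> 4 dvd l - l'" ..
next
  assume dvd: "int n dvd k - k' \<and> 4 dvd l - l'"
  show "codeword k l = codeword k' l'"
  proof (rule eq_vec_positionI)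
    fix i j :: int assume j: "j = 0 \<or> j = 1"
    have "int n dvd - (k - k')" "4 dvd - (l - l')" using dvd by (simp_all only: dvd_minus_iff)
    then have "int n dvd (i - k) - (i - k')" "4 dvd (j - l) - (j - l')" by simp_all
    then have "\<beta> (i - k) = \<beta> (i - k')" by (intro periodic_dvd)
    moreover have "quarter_bit (j - l) = quarter_bit (j - l')"
      using \<open>4 dvd (j - l) - (j - l')\<close> by (rule quarter_bit_cong)
    ultimately show "codeword k l $ position i j = codeword k' l' $ position i j"
      by (simp add: codeword_position[OF j])
  qed simp_all
qed

lemma codeword_zero: "codeword 0 0 = 0\<^sub>v (2 * n)"
proof (rule eq_vec_positionI)
  fix i j :: int assume j: "j = 0 \<or> j = 1"
  then have "quarter_bit j = 0" by (auto simp: quarter_bit_def)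
  then show "codeword 0 0 $ position i j = 0\<^sub>v (2 * n) $ position i j"
    by (simp add: codeword_position[OF j] position_less)
qed simp_all

lemma codeword_add_two: "codeword k (l + 2) = codeword k l + ones_vec (2 * n)"
proof (rule eq_vec_positionI)
  fix i j :: int assume j: "j = 0 \<or> j = 1"
  have "quarter_bit (j - l) = quarter_bit (j - (l + 2)) + 1"
    using quarter_bit_add_two[of "j - (l + 2)"] by simp
  then show "codeword k (l + 2) $ position i j = (codeword k l + ones_vec (2 * n)) $ position i j"
    by (simp add: ones_vec_def position_less codeword_position[OF j] add.assoc)
qed (simp_all add: ones_vec_def)

lemma codeword_ones: "codeword 0 2 = ones_vec (2 * n)"
proof -
  have "codeword 0 (0 + 2) = 0\<^sub>v (2 * n) + ones_vec (2 * n)"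
    unfolding codeword_add_two codeword_zero ..
  then show ?thesis by (simp add: ones_vec_def)
qed

text \<open>
  A translate of \<open>f\<close> by a product of group elements is a translate of a translate.  The normalizing
  summand of the second factor, moved by \<open>(k, l)\<close>, cancels against the first factor; on the \<open>C\<^sub>4\<close> side
  this is the cocycle identity.
\<close>

lemma codeword_mult:
  "codeword k l + permute_vec (translation k l) (codeword k' l') = codeword (k + k') (l + l')"
proof (rule eq_vec_positionI)
  fix i j :: int assume j: "j = 0 \<or> j = 1"
  have "permute_vec (translation k l) (codeword k' l') $ position i j
      = codeword k' l' $ position (i - k) (j - l)"
    by (simp add: permute_vec_def position_less translation_inverse translation_position)
  also have "\<dots> = \<beta> (i - (k + k')) + \<beta> (i - k) + quarter_bit ((j - l) mod 2 - l')"
    by (simp add: codeword_position_mod diff_diff_eq)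
  finally have perm: "permute_vec (translation k l) (codeword k' l') $ position i j
      = \<beta> (i - (k + k')) + \<beta> (i - k) + quarter_bit ((j - l) mod 2 - l')" .
  have regroup: "(a + b + c) + (d + a + e) = d + b + (c + e)" for a b c d e :: bit
    by (cases a; cases b; cases c; cases d; cases e) simp_all
  have dim: "dim_vec (permute_vec (translation k l) (codeword k' l')) = 2 * n"
    by (simp add: permute_vec_def)
  have "quarter_bit (j - (l + l')) = quarter_bit (j - l) + quarter_bit ((j - l) mod 2 - l')"
    using quarter_bit_cocycle[of "j - l" l'] by (simp add: diff_diff_eq)
  then have "codeword (k + k') (l + l') $ position i j
      = \<beta> (i - (k + k')) + \<beta> i + (quarter_bit (j - l) + quarter_bit ((j - l) mod 2 - l'))"
    by (simp only: codeword_position[OF j])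
  also have "\<dots> = codeword k l $ position i j
      + permute_vec (translation k l) (codeword k' l') $ position i j"
    unfolding perm codeword_position[OF j] by (rule regroup[symmetric])
  also have "\<dots> = (codeword k l + permute_vec (translation k l) (codeword k' l')) $ position i j"
    by (rule index_add_vec(1)[symmetric]) (simp add: dim position_less)
  finally show "(codeword k l + permute_vec (translation k l) (codeword k' l')) $ position i j
      = codeword (k + k') (l + l') $ position i j" ..
qed (auto intro!: carrier_vecI simp: permute_vec_def)


definition code :: "bit vec set" where
  "code = {codeword k l | k l. True}"

lemma codeword_in_code [simp]: "codeword k l \<in> code"
  unfolding code_def by blast

lemma code_cases:
  assumes "x \<in> code"
  obtains k l where "x = codeword k l"
  using assms unfolding code_def by blast

lemma code_carrier: "code \<subseteq> carrier_vec (2 * n)"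
  by (auto elim: code_cases)

lemma zero_in_code: "0\<^sub>v (2 * n) \<in> code"
  using codeword_in_code[of 0 0] unfolding codeword_zero .

section \<open>Orthogonality\<close>

lemma sum_positions:
  "(\<Sum>p<2 * n. F p) = (\<Sum>i<n. F (position (int i) 0)) + (\<Sum>i<n. F (position (int i) 1) :: int)"
proof -
  have "(\<Sum>p<n + m. F p) = (\<Sum>i<n. F i) + (\<Sum>i<m. F (i + n))" for m
    by (induction m) (simp_all add: add.commute)
  moreover have "position (int i) 0 = i" "position (int i) 1 = i + n" if "i < n" for i
    using that by (simp_all add: position_def)
  ultimately show ?thesis by (simp add: mult_2)
qed

text \<open>
  The inner product is that of two rows of a Kronecker product, a correlation of \<open>\<beta>\<close> times an inner
  product in dimension \<open>2\<close>.
\<close>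

lemma codeword_inner_product:
  "(\<Sum>p<2 * n. bit_sign (codeword k l $ p) * bit_sign (codeword k' l' $ p)) =
     (if int n dvd k - k' then int n else 0) *
     (bit_sign (quarter_bit (0 - l) + quarter_bit (0 - l'))
       + bit_sign (quarter_bit (1 - l) + quarter_bit (1 - l')))"
proof -
  have block: "(\<Sum>i<n. bit_sign (codeword k l $ position (int i) j) * bit_sign (codeword k' l' $ position (int i) j))
      = (if int n dvd k - k' then int n else 0) * bit_sign (quarter_bit (j - l) + quarter_bit (j - l'))"
    if j: "j = 0 \<or> j = 1" for j
  proof -
    have regroup: "(a + b + c) + (d + b + e) = (a + d) + (c + e)" for a b c d e :: bit
      by (cases a; cases b; cases c; cases d; cases e) simp_all
    have "bit_sign (codeword k l $ position (int i) j) * bit_sign (codeword k' l' $ position (int i) j)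
        = bit_sign (\<beta> (int i + (- k)) + \<beta> (int i + (- k'))) * bit_sign (quarter_bit (j - l) + quarter_bit (j - l'))"
      for i
      unfolding codeword_position[OF j] bit_sign_add[symmetric] regroup by simp
    then show ?thesis
      using crosscorrelation[of "- k" "- k'"] by (simp add: sum_distrib_right[symmetric])
  qed
  show ?thesis
    unfolding sum_positions using block[of 0] block[of 1] by (simp add: distrib_left)
qed

text \<open>
  The rows are the codewords with second index \<open>0\<close> or \<open>1\<close>; the indices \<open>2\<close> and \<open>3\<close> give their complements.
\<close>

definition code_matrix :: "int mat" where
  "code_matrix = mat (2 * n) (2 * n)
     (\<lambda>(r, p). bit_sign (codeword (int (r mod n)) (int (r div n)) $ p))"

lemma code_matrix_hadamard: "hadamard_matrix (2 * n) code_matrix"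
  unfolding hadamard_matrix_def
proof (intro conjI)
  show carrier: "code_matrix \<in> carrier_mat (2 * n) (2 * n)" by (simp add: code_matrix_def)
  show "elements_mat code_matrix \<subseteq> {1, -1}"
  proof
    fix x assume "x \<in> elements_mat code_matrix"
    then obtain r p where "r < 2 * n" "p < 2 * n" "x = code_matrix $$ (r, p)"
      using carrier by (auto dest!: elements_matD)
    then show "x \<in> {1, -1}"
      using bit_sign_eq_one_or_minus_one by (auto simp: code_matrix_def)
  qed
  show "code_matrix * code_matrix\<^sup>T = of_nat (2 * n) \<cdot>\<^sub>m 1\<^sub>m (2 * n)"
  proof (rule eq_matI)
    fix r s assume "r < dim_row (of_nat (2 * n) \<cdot>\<^sub>m 1\<^sub>m (2 * n) :: int mat)"
      and "s < dim_col (of_nat (2 * n) \<cdot>\<^sub>m 1\<^sub>m (2 * n) :: int mat)"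
    then have r: "r < 2 * n" and s: "s < 2 * n" by simp_all
    then have blocks: "r div n < 2" "s div n < 2"
      using length_pos by (simp_all add: div_less_iff_less_mult)
    have "(code_matrix * code_matrix\<^sup>T) $$ (r, s)
        = (\<Sum>p<2 * n. bit_sign (codeword (int (r mod n)) (int (r div n)) $ p)
            * bit_sign (codeword (int (s mod n)) (int (s div n)) $ p))"
      using r s by (simp add: code_matrix_def scalar_prod_def atLeast0LessThan)
    also have "\<dots> = (if int n dvd int (r mod n) - int (s mod n) then int n else 0) *
        (bit_sign (quarter_bit (0 - int (r div n)) + quarter_bit (0 - int (s div n)))
          + bit_sign (quarter_bit (1 - int (r div n)) + quarter_bit (1 - int (s div n))))"
      by (rule codeword_inner_product)
    also have "int n dvd int (r mod n) - int (s mod n) \<longleftrightarrow> r mod n = s mod n"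
      by (simp add: mod_eq_dvd_iff[symmetric] flip: of_nat_mod)
    also have "bit_sign (quarter_bit (0 - int (r div n)) + quarter_bit (0 - int (s div n)))
          + bit_sign (quarter_bit (1 - int (r div n)) + quarter_bit (1 - int (s div n)))
        = (if r div n = s div n then 2 else 0)"
      using blocks by (auto simp: less_2_cases_iff quarter_bit_def)
    also have "(if r mod n = s mod n then int n else 0) * (if r div n = s div n then 2 else 0)
        = (if r = s then 2 * int n else 0)"
    proof (cases "r = s")
      case False
      then have "r mod n \<noteq> s mod n \<or> r div n \<noteq> s div n" by (metis div_mult_mod_eq)
      then show ?thesis using False by auto
    qed simp
    finally show "(code_matrix * code_matrix\<^sup>T) $$ (r, s) = (of_nat (2 * n) \<cdot>\<^sub>m 1\<^sub>m (2 * n)) $$ (r, s)"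
      using r s by simp
  qed (simp_all add: code_matrix_def)
qed

lemma code_eq_rows_and_complements:
  "code = rows_and_complements (2 * n) (binary_matrix code_matrix)"
proof -
  let ?B = "binary_matrix code_matrix"
  have row: "row ?B r = codeword (int (r mod n)) (int (r div n))" if "r < 2 * n" for r
    by (rule eq_vecI) (use that in \<open>auto simp: binary_matrix_def code_matrix_def bit_sign_def\<close>)
  have rows: "set (rows ?B) = {codeword (int (r mod n)) (int (r div n)) | r. r < 2 * n}"
    using row unfolding rows_def by (auto simp: binary_matrix_def code_matrix_def image_iff)
  have row_codeword: "codeword k l \<in> set (rows ?B)" if "l mod 4 < 2" for k l
  proof -
    define r where "r = position k (l mod 4)"
    have "l mod 4 = 0 \<or> l mod 4 = 1" using that by linarith
    then have "int (r div n) = l mod 4" unfolding r_def position_div by auto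
    then have "codeword k l = codeword (int (r mod n)) (int (r div n))"
      unfolding codeword_eq_iff r_def position_mod by (simp add: mod_eq_dvd_iff[symmetric])
    then show ?thesis unfolding rows using position_less r_def by blast
  qed
  show ?thesis
  proof (intro equalityI subsetI)
    fix x assume "x \<in> code"
    then obtain k l where x: "x = codeword k l" by (rule code_cases)
    show "x \<in> rows_and_complements (2 * n) ?B"
    proof (cases "l mod 4 < 2")
      case True
      then show ?thesis unfolding x rows_and_complements_def using row_codeword by blast
    next
      case False
      then have "(l - 2) mod 4 < 2" by presburger
      moreover have "x = codeword k (l - 2) + ones_vec (2 * n)"
        unfolding x codeword_add_two[symmetric] by simp
      ultimately show ?thesis unfolding rows_and_complements_def using row_codeword by blast
    qed
  next
    fix x assume "x \<in> rows_and_complements (2 * n) ?B"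
    then show "x \<in> code"
      unfolding rows_and_complements_def rows by (auto simp: codeword_add_two[symmetric])
  qed
qed

lemma hadamard_code_code: "hadamard_code (2 * n) code"
  unfolding hadamard_code_def
  using code_matrix_hadamard code_eq_rows_and_complements zero_in_code by blast

section \<open>The group structure\<close>

text \<open>
  The two indices are chosen independently of each other.  This is harmless because each is determined by the
  codeword modulo \<open>n\<close> and modulo \<open>4\<close>, and the translation depends on them only modulo \<open>n\<close> and \<open>2\<close>.
\<close>

definition action :: "bit vec \<Rightarrow> nat \<Rightarrow> nat" where
  "action x = translation (SOME k. \<exists>l. x = codeword k l) (SOME l. \<exists>k. x = codeword k l)"

lemma action_codeword: "action (codeword k l) = translation k l"
proof -
  define k' where "k' = (SOME k'. \<exists>l'. codeword k l = codeword k' l')"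
  define l' where "l' = (SOME l'. \<exists>k'. codeword k l = codeword k' l')"
  have "\<exists>l'. codeword k l = codeword k' l'" unfolding k'_def by (rule someI) (rule exI, rule refl)
  moreover have "\<exists>k'. codeword k l = codeword k' l'" unfolding l'_def by (rule someI) (rule exI, rule refl)
  ultimately have "int n dvd k - k'" "4 dvd l - l'" unfolding codeword_eq_iff by blast+
  moreover from \<open>4 dvd l - l'\<close> have "2 dvd l - l'" by presburger
  ultimately have "translation k l = translation k' l'" by (intro translation_eq)
  then show ?thesis unfolding action_def k'_def l'_def by simp
qed

lemma propelinear_mult_codeword:
  "propelinear_mult action (codeword k l) (codeword k' l') = codeword (k + k') (l + l')"
  unfolding propelinear_mult_def action_codeword by (rule codeword_mult)

lemma propelinear_structure_code: "propelinear_structure (2 * n) code action"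
  unfolding propelinear_structure_def
  by (auto intro: translation_permutes code_carrier[THEN subsetD] elim!: code_cases
      simp: action_codeword propelinear_mult_codeword translation_comp)

lemma hfp_code_code: "hfp_code (2 * n) code action"
  unfolding hfp_code_def
proof (intro conjI ballI allI impI notI)
  fix x p assume x: "x \<in> code - {0\<^sub>v (2 * n), ones_vec (2 * n)}" and p: "p < 2 * n" "action x p = p"
  from x obtain k l where kl: "x = codeword k l" by (auto elim: code_cases)
  have "int n dvd k" "2 dvd l"
    using translation_fixed_point[OF p(1)] p(2) unfolding kl action_codeword by blast+
  moreover from \<open>2 dvd l\<close> have "4 dvd l \<or> 4 dvd l - 2" by presburger
  ultimately have "x = codeword 0 0 \<or> x = codeword 0 2" unfolding kl codeword_eq_iff by auto
  then show False using x by (simp add: codeword_zero codeword_ones)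
next
  show "action (0\<^sub>v (2 * n)) = id" unfolding codeword_zero[symmetric] action_codeword by (rule translation_zero)
  have "translation 0 2 = translation 0 0" by (rule translation_eq) simp_all
  then show "action (ones_vec (2 * n)) = id"
    unfolding codeword_ones[symmetric] action_codeword by (simp add: translation_zero)
qed (rule hadamard_code_code propelinear_structure_code)+

abbreviation code_group :: "bit vec monoid" where
  "code_group \<equiv> propelinear_group (2 * n) code action"

lemma code_group_simps [simp]:
  "carrier code_group = code" "\<one>\<^bsub>code_group\<^esub> = codeword 0 0"
  "codeword k l \<otimes>\<^bsub>code_group\<^esub> codeword k' l' = codeword (k + k') (l + l')"
  by (simp_all add: propelinear_group_def codeword_zero propelinear_mult_codeword)

lemma group_code_group: "group code_group"
proof (rule groupI)
  fix x assume "x \<in> carrier code_group"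
  then obtain k l where "x = codeword k l" by (auto elim: code_cases)
  then have "codeword (- k) (- l) \<otimes>\<^bsub>code_group\<^esub> x = \<one>\<^bsub>code_group\<^esub>" by simp
  then show "\<exists>y\<in>carrier code_group. y \<otimes>\<^bsub>code_group\<^esub> x = \<one>\<^bsub>code_group\<^esub>" by force
qed (auto elim!: code_cases simp: add.assoc)

lemma code_direct_product:
  defines "A \<equiv> subgroup_generated code_group {codeword 1 0}"
    and "B \<equiv> subgroup_generated code_group {codeword 0 1}"
  shows "(\<lambda>(x, y). x \<otimes>\<^bsub>code_group\<^esub> y) \<in> iso (A \<times>\<times> B) code_group"
    and "A \<cong> integer_mod_group n" and "B \<cong> integer_mod_group 4"
    and "codeword 1 0 [^]\<^bsub>code_group\<^esub> n = 0\<^sub>v (2 * n)"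
    and "codeword 0 1 [^]\<^bsub>code_group\<^esub> (2::nat) = ones_vec (2 * n)"
proof -
  interpret group code_group by (rule group_code_group)
  note A_image = integer_parametrization[of "\<lambda>i. codeword i 0"]
  note B_image = integer_parametrization[of "\<lambda>i. codeword 0 i"]
  have A: "carrier A = range (\<lambda>i. codeword i 0)" unfolding A_def by (rule A_image(2)) simp_all
  have B: "carrier B = range (\<lambda>i. codeword 0 i)" unfolding B_def by (rule B_image(2)) simp_all
  have mult: "mult A = mult code_group" "mult B = mult code_group" unfolding A_def B_def by simp_all
  show "A \<cong> integer_mod_group n" unfolding A_def
    by (rule A_image(3)) (simp_all add: codeword_eq_iff length_pos)
  show "B \<cong> integer_mod_group 4" unfolding B_def
    by (rule B_image(3)) (simp_all add: codeword_eq_iff)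
  have "codeword 1 0 [^]\<^bsub>code_group\<^esub> int n = codeword (int n) 0" by (rule A_image(1)) simp_all
  then show "codeword 1 0 [^]\<^bsub>code_group\<^esub> n = 0\<^sub>v (2 * n)"
    unfolding int_pow_int codeword_zero[symmetric] by (simp add: codeword_eq_iff)
  have "codeword 0 1 [^]\<^bsub>code_group\<^esub> int 2 = codeword 0 (int 2)" by (rule B_image(1)) simp_all
  then show "codeword 0 1 [^]\<^bsub>code_group\<^esub> (2::nat) = ones_vec (2 * n)"
    unfolding int_pow_int codeword_ones[symmetric] by simp
  show "(\<lambda>(x, y). x \<otimes>\<^bsub>code_group\<^esub> y) \<in> iso (A \<times>\<times> B) code_group"
  proof (rule isoI)
    show "(\<lambda>(x, y). x \<otimes>\<^bsub>code_group\<^esub> y) \<in> hom (A \<times>\<times> B) code_group"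
      by (rule homI) (auto simp: A B mult add.assoc add.left_commute)
    show "bij_betw (\<lambda>(x, y). x \<otimes>\<^bsub>code_group\<^esub> y) (carrier (A \<times>\<times> B)) (carrier code_group)"
      unfolding bij_betw_def
    proof
      show "inj_on (\<lambda>(x, y). x \<otimes>\<^bsub>code_group\<^esub> y) (carrier (A \<times>\<times> B))"
        by (rule inj_onI) (auto simp: A B codeword_eq_iff)
      have "codeword k l \<in> (\<lambda>(x, y). x \<otimes>\<^bsub>code_group\<^esub> y) ` carrier (A \<times>\<times> B)" for k l
        by (rule image_eqI[of _ _ "(codeword k 0, codeword 0 l)"]) (simp_all add: A B)
      then show "(\<lambda>(x, y). x \<otimes>\<^bsub>code_group\<^esub> y) ` carrier (A \<times>\<times> B) = carrier code_group"
        by (auto simp: A B elim!: code_cases)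
    qed
  qed
qed

section \<open>The kernel\<close>

text \<open>
  All four functions on the two halves occur, which is why the codewords \<open>codeword 0 l\<close> form a linear space.
\<close>

lemma quarter_bit_pattern: "\<exists>l. quarter_bit (0 - l) = a \<and> quarter_bit (1 - l) = b"
proof -
  have "quarter_bit (0 - 0) = 0" "quarter_bit (1 - 0) = 0" "quarter_bit (0 - 1) = 1" "quarter_bit (1 - 1) = 0"
    "quarter_bit (0 - 2) = 1" "quarter_bit (1 - 2) = 1" "quarter_bit (0 - 3) = 0" "quarter_bit (1 - 3) = 1"
    by (simp_all add: quarter_bit_def)
  then show ?thesis by (cases a; cases b) metis+
qed

lemma codeword_add_fibre: "\<exists>m. codeword k l + codeword 0 l' = codeword k m"
proof -
  obtain m where m: "quarter_bit (0 - m) = quarter_bit (0 - l) + quarter_bit (0 - l')"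
    "quarter_bit (1 - m) = quarter_bit (1 - l) + quarter_bit (1 - l')"
    using quarter_bit_pattern by blast
  have "codeword k l + codeword 0 l' = codeword k m"
  proof (rule eq_vec_positionI)
    fix i j :: int assume j: "j = 0 \<or> j = 1"
    then have "quarter_bit (j - m) = quarter_bit (j - l) + quarter_bit (j - l')" using m by auto
    then show "(codeword k l + codeword 0 l') $ position i j = codeword k m $ position i j"
      by (simp add: codeword_position[OF j] position_less add.assoc)
  qed simp_all
  then show ?thesis ..
qed

text \<open>
  A kernel vector is itself a codeword, as the zero vector is in the code.  On the first half of the
  coordinates its defining property says that \<open>\<beta>(i - k) + \<beta>(i)\<close> is in the kernel of the shifts of \<open>\<beta>\<close>, hence
  is constant, so that \<open>n\<close> divides \<open>k\<close>.
\<close>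

lemma code_kernel_eq_fibre:
  assumes "n = 4 * t" and "1 < t"
  shows "code_kernel (2 * n) code = range (codeword 0)"
proof (intro equalityI subsetI)
  fix z assume "z \<in> code_kernel (2 * n) code"
  then have carrier: "z \<in> carrier_vec (2 * n)" and closed: "(\<lambda>x. x + z) ` code = code"
    by (simp_all add: code_kernel_def)
  have "0\<^sub>v (2 * n) + z \<in> code" using closed zero_in_code by blast
  then obtain k l where z: "z = codeword k l" using carrier by (auto elim: code_cases)
  have "(\<lambda>i. \<beta> (i - k) + \<beta> i) \<in> sequence_kernel"
    unfolding sequence_kernel_def
  proof (intro CollectI allI)
    fix m
    have "codeword (- m) 0 + z \<in> code" using closed codeword_in_code by blast
    then obtain k' l' where sum: "codeword (- m) 0 + codeword k l = codeword k' l'"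
      unfolding z by (rule code_cases)
    have regroup: "c + b + a = d + (e + f)" if "(a + b + 0) + (c + b + e) = d + b + f" for a b c d e f :: bit
      using that by (cases a; cases b; cases c; cases d; cases e; cases f) simp_all
    have "\<beta> (i - k) + \<beta> i + \<beta> (i + m) = \<beta> (i + (- k')) + (quarter_bit (0 - l) + quarter_bit (0 - l'))" for i
    proof -
      have "codeword (- m) 0 $ position i 0 + codeword k l $ position i 0 = codeword k' l' $ position i 0"
        unfolding sum[symmetric] by (rule index_add_vec(1)[symmetric]) (simp add: position_less)
      moreover have "quarter_bit 0 = 0" by (simp add: quarter_bit_def)
      ultimately have "(\<beta> (i + m) + \<beta> i + 0) + (\<beta> (i - k) + \<beta> i + quarter_bit (0 - l))
          = \<beta> (i + (- k')) + \<beta> i + quarter_bit (0 - l')"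
        by (simp add: codeword_position)
      then show ?thesis by (rule regroup)
    qed
    then show "\<exists>k' c. \<forall>i. \<beta> (i - k) + \<beta> i + \<beta> (i + m) = \<beta> (i + k') + c" by blast
  qed
  then have const: "\<beta> (i - k) + \<beta> i = \<beta> (0 - k) + \<beta> 0" for i
    using sequence_kernel_constant[OF assms] by blast
  have "\<beta> (i + (- k)) = \<beta> (i + 0) + (\<beta> (0 - k) + \<beta> 0)" for i
    using const[of i] unfolding bit_add_eq_iff by (simp add: add.commute)
  then have "int n dvd - k - 0" by (rule shift_eq_up_to_constant(1))
  then have "z = codeword 0 l" unfolding z codeword_eq_iff by simp
  then show "z \<in> range (codeword 0)" by simp
next
  fix z assume "z \<in> range (codeword 0)"
  then obtain l where z: "z = codeword 0 l" by blast
  have closed: "x + z \<in> code" if x: "x \<in> code" for x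
  proof -
    from x obtain k l' where "x = codeword k l'" by (rule code_cases)
    then show ?thesis using codeword_add_fibre[of k l' l] unfolding z by auto
  qed
  have "x \<in> (\<lambda>x. x + z) ` code" if x: "x \<in> code" for x
  proof (rule image_eqI)
    from x have "x \<in> carrier_vec (2 * n)" using code_carrier by blast
    then show "x = x + z + z" unfolding z by (intro eq_vecI) (auto simp: add.assoc)
  qed (rule closed[OF x])
  then show "z \<in> code_kernel (2 * n) code"
    unfolding code_kernel_def using closed z by auto
qed

lemma codeword_half: "codeword 0 3 = 0\<^sub>v n @\<^sub>v ones_vec n"
proof (rule eq_vecI)
  fix p assume "p < dim_vec (0\<^sub>v n @\<^sub>v ones_vec n :: bit vec)"
  then have p: "p < 2 * n" by (simp add: ones_vec_def)
  have "p div n = (if p < n then 0 else 1)"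
    using p length_pos by (auto simp: div_eq_dividend_iff intro!: div_nat_eqI)
  then show "codeword 0 3 $ p = (0\<^sub>v n @\<^sub>v ones_vec n) $ p"
    using p by (auto simp: codeword_def ones_vec_def quarter_bit_def)
qed (simp add: ones_vec_def)

lemma fibre_eq_span:
  "range (codeword 0) = binary_span (2 * n) {ones_vec (2 * n), 0\<^sub>v n @\<^sub>v ones_vec n}"
proof -
  interpret vec_space "TYPE(bit)" "2 * n" .
  let ?u = "codeword 0 2" and ?v = "codeword 0 3"
  have carrier: "{?u, ?v} \<subseteq> carrier_vec (2 * n)" by simp
  have distinct: "?u \<noteq> ?v" unfolding codeword_eq_iff by simp
  have lincomb: "lincomb a {?u, ?v} = a ?u \<cdot>\<^sub>v ?u + a ?v \<cdot>\<^sub>v ?v" for a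
    unfolding lincomb_def using distinct by (simp add: Pi_def)
  show ?thesis
    unfolding codeword_ones[symmetric] codeword_half[symmetric]
  proof (intro equalityI subsetI)
    fix z assume "z \<in> span {?u, ?v}"
    then obtain a where z: "z = a ?u \<cdot>\<^sub>v ?u + a ?v \<cdot>\<^sub>v ?v"
      using finite_span[of "{?u, ?v}"] carrier lincomb by auto
    have scaled: "c \<cdot>\<^sub>v codeword 0 l \<in> range (codeword 0)" for c l
    proof (cases "c = 0")
      case True
      then have "c \<cdot>\<^sub>v codeword 0 l = codeword 0 0" unfolding codeword_zero by (intro eq_vecI) simp_all
      then show ?thesis by simp
    next
      case False
      then have "c \<cdot>\<^sub>v codeword 0 l = codeword 0 l" by (intro eq_vecI) simp_all
      then show ?thesis by simp
    qed
    obtain l l' where "a ?u \<cdot>\<^sub>v ?u = codeword 0 l" "a ?v \<cdot>\<^sub>v ?v = codeword 0 l'"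
      using scaled[of "a ?u" 2] scaled[of "a ?v" 3] by blast
    then show "z \<in> range (codeword 0)" using codeword_add_fibre[of 0 l l'] unfolding z by auto
  next
    fix z assume "z \<in> range (codeword 0)"
    then obtain l where z: "z = codeword 0 l" by blast
    have u: "?u \<in> span {?u, ?v}" and v: "?v \<in> span {?u, ?v}" using in_own_span[of "{?u, ?v}"] by auto
    have uv: "?v + ?u \<in> span {?u, ?v}" using span_add1[OF _ v u] by simp
    have zero: "codeword 0 0 \<in> span {?u, ?v}" using span_zero unfolding codeword_zero by simp
    have "?v + ?u = codeword 0 5"
      unfolding codeword_ones codeword_add_two[symmetric] by simp
    with uv have five: "codeword 0 5 \<in> span {?u, ?v}" by simp
    have "4 dvd l - 0 \<or> 4 dvd l - 5 \<or> 4 dvd l - 2 \<or> 4 dvd l - 3" by presburger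
    then have "z \<in> {codeword 0 0, codeword 0 5, codeword 0 2, codeword 0 3}"
      unfolding z by (auto simp: codeword_eq_iff)
    then show "z \<in> span {?u, ?v}" using u v five zero by blast
  qed
qed

end

section \<open>From circulant Hadamard matrices to codes\<close>

text \<open>
  The inner product of the first row with the row at distance \<open>-k\<close> is the autocorrelation at \<open>k\<close>.
\<close>

lemma perfect_binary_sequence_of_circulant_hadamard_matrix:
  assumes H: "hadamard_matrix n H" and circulant: "circulant_matrix n H" and n: "0 < n"
  shows "\<exists>\<beta>. perfect_binary_sequence n \<beta>"
proof -
  obtain v where H_eq: "H = mat n n (\<lambda>(i, j). v $ ((j + n - i) mod n))"
    using circulant unfolding circulant_matrix_def by blast
  have entry: "H $$ (i, j) = v $ ((j + n - i) mod n)" if "i < n" "j < n" for i j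
    using that unfolding H_eq by simp
  have sign: "v $ j = 1 \<or> v $ j = -1" if "j < n" for j
  proof -
    have "H $$ (0, j) = v $ j" using entry[of 0 j] n that by simp
    moreover have "H $$ (0, j) \<in> elements_mat H"
      using H n that unfolding hadamard_matrix_def by blast
    ultimately show ?thesis using H unfolding hadamard_matrix_def by auto
  qed
  define \<beta> :: "int \<Rightarrow> bit" where "\<beta> x = (if v $ nat (x mod int n) = 1 then 0 else 1)" for x
  have sign_beta: "bit_sign (\<beta> x) = v $ nat (x mod int n)" for x
  proof -
    have "nat (x mod int n) < n" using n by (simp add: nat_less_iff)
    from sign[OF this] show ?thesis by (auto simp: \<beta>_def)
  qed
  have "perfect_binary_sequence n \<beta>"
  proof
    show "0 < n" by (rule n)
    show "\<beta> (x + int n) = \<beta> x" for x by (simp add: \<beta>_def)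
    show "(\<Sum>x<n. bit_sign (\<beta> (int x) + \<beta> (int x + k))) = (if int n dvd k then int n else 0)" for k
    proof -
      define d where "d = nat (- k mod int n)"
      have d: "d < n" and d_int: "int d = - k mod int n" using n by (simp_all add: d_def nat_less_iff)
      have first_row: "bit_sign (\<beta> (int x)) = H $$ (0, x)" if "x < n" for x
        using entry[of 0 x] n that unfolding sign_beta by simp
      have later_row: "bit_sign (\<beta> (int x + k)) = H $$ (d, x)" if "x < n" for x
      proof -
        have "int ((x + n - d) mod n) = (int x + int n - int d) mod int n"
          using d by (simp add: of_nat_mod of_nat_diff)
        also have "\<dots> = (int x + int n - (- k)) mod int n" unfolding d_int by (rule mod_diff_right_eq)
        also have "\<dots> = (int x + k + int n) mod int n" by (simp add: algebra_simps)
        also have "\<dots> = (int x + k) mod int n" by simp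
        finally have "nat ((int x + k) mod int n) = (x + n - d) mod n" by (metis nat_int)
        then show ?thesis unfolding sign_beta entry[OF d that] by simp
      qed
      have carrier: "H \<in> carrier_mat n n" using H unfolding hadamard_matrix_def by blast
      have "(\<Sum>x<n. bit_sign (\<beta> (int x) + \<beta> (int x + k))) = (\<Sum>x<n. H $$ (0, x) * H $$ (d, x))"
        by (rule sum.cong) (simp_all add: bit_sign_add first_row later_row)
      also have "\<dots> = (H * H\<^sup>T) $$ (0, d)"
        using carrier n d by (simp add: scalar_prod_def atLeast0LessThan)
      also have "\<dots> = (if d = 0 then int n else 0)"
        using H n d unfolding hadamard_matrix_def by simp
      also have "d = 0 \<longleftrightarrow> int n dvd k"
        using d_int by (metis dvd_eq_mod_eq_0 dvd_minus_iff of_nat_eq_0_iff)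
      finally show ?thesis .
    qed
  qed
  then show ?thesis by blast
qed

theorem proposition3p25:
  fixes t :: nat
  assumes "0 < t"
    and "\<exists>D. circulant_hadamard_code (4 * t) D"
  shows "\<exists>C \<pi>. hfp_4t_4u_code t C \<pi> \<and>
    (t \<noteq> 1 \<longrightarrow>
      code_kernel (8 * t) C =
        binary_span (8 * t) {ones_vec (8 * t), 0\<^sub>v (4 * t) @\<^sub>v ones_vec (4 * t)})"
proof -
  obtain H where "hadamard_matrix (4 * t) H" and "circulant_matrix (4 * t) H"
    using assms(2) unfolding circulant_hadamard_code_def by blast
  then obtain \<beta> where "perfect_binary_sequence (4 * t) \<beta>"
    using perfect_binary_sequence_of_circulant_hadamard_matrix assms(1) by fastforce
  then interpret perfect_binary_sequence "4 * t" \<beta> .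
  have length: "8 * t = 2 * (4 * t)" by simp
  have "hfp_4t_4u_code t code action"
    unfolding hfp_4t_4u_code_def Let_def length
    using hfp_code_code code_direct_product codeword_in_code by blast
  moreover have "code_kernel (8 * t) code =
      binary_span (8 * t) {ones_vec (8 * t), 0\<^sub>v (4 * t) @\<^sub>v ones_vec (4 * t)}" if "t \<noteq> 1"
    unfolding length using code_kernel_eq_fibre[of t] fibre_eq_span assms(1) that by simp
  ultimately show ?thesis by blast
qed

end
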